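(* Let $A$ be an abelian group and $c\in A$. There is an exact sequence $$0\to \mathrm{Ann}_3(A)\xrightarrow{\beta}\mathrm{Aut}_E({}_cA)\xrightarrow{\alpha}\mathrm{Aut}(A)\xrightarrow{\eta}A/3A,$$ where $\mathrm{Ann}_3(A)=\{a\in A\mid 3a=0\}$ and the maps are defined by $$\beta(a)=a+1_A,\qquad \alpha(f_0+f_1)=f_1,\qquad \eta(g)=c-g(c)+3A,$$ for $a\in \mathrm{Ann}_3(A)$, $f=f_0+f_1\in\mathrm{Aut}_E({}_cA)$ and $g\in\mathrm{Aut}(A)$.
   Context: An elliptic group is a set $S$ with a binary operation $\ast$ satisfying, for all $x,y,z,w\in S$: (EG1) $x\ast y=y\ast x$; (EG2) $x\ast(x\ast y)=y$; (EG3) $x\ast(y\ast(z\ast w))=w\ast(y\ast(z\ast x))$. A morphism of elliptic groups is a map $f$ with $f(x\ast y)=f(x)\ast f(y)$. For an (additive) abelian group $A$ and $c\in A$, ${}_cA$ denotes the elliptic group with underlying set $A$ and operation $x\ast_c y=c-x-y$. $\mathrm{Aut}_E(S)$ is the group (under composition) of automorphisms of $S$ in the category of elliptic groups, and $\mathrm{Aut}(A)$ is the group of automorphisms of the abelian group $A$. Every morphism $f:{}_cA\to{}_cA$ can be written uniquely as $f(x)=f_0+f_1(x)$ with $f_0=f(0)\in A$ and $f_1:A\to A$ a group homomorphism (and $3f_0+f_1(c)=c$). $\beta(a)=a+1_A$ is the map $x\mapsto a+x$. The maps $\beta,\alpha$ are group homomorphisms, while $\eta$ is only a map of pointed sets in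 general; exactness at $\mathrm{Aut}(A)$ means $\mathrm{im}(\alpha)=\{g\in \mathrm{Aut}(A)\mid\eta(g)=0\}$. *)

theory Defs
  imports "HOL-Algebra.Algebra"
begin

section \<open>Elliptic groups\<close>

record 'a elliptic = "'a partial_object" +
  star :: "'a \<Rightarrow> 'a \<Rightarrow> 'a"  (infixl \<open>\<star>\<index>\<close> 70)

locale elliptic_group =
  fixes S (structure)
  assumes star_closed: "\<lbrakk>x \<in> carrier S; y \<in> carrier S\<rbrakk> \<Longrightarrow> x \<star> y \<in> carrier S"
    and EG1: "\<lbrakk>x \<in> carrier S; y \<in> carrier S\<rbrakk> \<Longrightarrow> x \<star> y = y \<star> x"
    and EG2: "\<lbrakk>x \<in> carrier S; y \<in> carrier S\<rbrakk> \<Longrightarrow> x \<star> (x \<star> y) = y"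
    and EG3: "\<lbrakk>x \<in> carrier S; y \<in> carrier S; z \<in> carrier S; w \<in> carrier S\<rbrakk>
      \<Longrightarrow> x \<star> (y \<star> (z \<star> w)) = w \<star> (y \<star> (z \<star> x))"

definition elliptic_hom :: "('a, 'm) elliptic_scheme \<Rightarrow> ('b, 'n) elliptic_scheme \<Rightarrow> ('a \<Rightarrow> 'b) set"
  where "elliptic_hom S T = {f. f \<in> carrier S \<rightarrow> carrier T \<and>
    (\<forall>x\<in>carrier S. \<forall>y\<in>carrier S. f (x \<star>\<^bsub>S\<^esub> y) = f x \<star>\<^bsub>T\<^esub> f y)}"

text \<open>Automorphisms in the categorical sense (endomorphisms with a two-sided inverse morphism).
  As for \<^const>\<open>auto\<close>, functions are required to be extensional, so that a self-map
  of the carrier is represented by exactly one HOL function.\<close>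

definition elliptic_auto :: "('a, 'm) elliptic_scheme \<Rightarrow> ('a \<Rightarrow> 'a) set"
  where "elliptic_auto S = {f \<in> elliptic_hom S S \<inter> extensional (carrier S).
    \<exists>g\<in>elliptic_hom S S. \<forall>x\<in>carrier S. g (f x) = x \<and> f (g x) = x}"

definition EllipticAutoGroup :: "('a, 'm) elliptic_scheme \<Rightarrow> ('a \<Rightarrow> 'a) monoid"
  where "EllipticAutoGroup S = BijGroup (carrier S) \<lparr>carrier := elliptic_auto S\<rparr>"

section \<open>The maps attached to an abelian group\<close>

text \<open>Abelian groups are \<^locale>\<open>comm_group\<close>s and hence written multiplicatively:
  \<open>x + y\<close>, \<open>0\<close>, \<open>- x\<close> and \<open>3 x\<close> become \<open>x \<otimes> y\<close>, \<open>\<one>\<close>, \<open>inv x\<close> and \<open>x [^] 3\<close>.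
  \<open>elliptic_of A c\<close> is the elliptic group \<open>\<^sub>cA\<close> with operation \<open>c - x - y\<close>.\<close>

definition elliptic_of :: "('a, 'm) monoid_scheme \<Rightarrow> 'a \<Rightarrow> 'a elliptic"
  where "elliptic_of A c =
    \<lparr>carrier = carrier A, star = (\<lambda>x y. c \<otimes>\<^bsub>A\<^esub> inv\<^bsub>A\<^esub> x \<otimes>\<^bsub>A\<^esub> inv\<^bsub>A\<^esub> y)\<rparr>"

definition Ann3 :: "('a, 'm) monoid_scheme \<Rightarrow> 'a set"
  where "Ann3 A = {a \<in> carrier A. a [^]\<^bsub>A\<^esub> (3::nat) = \<one>\<^bsub>A\<^esub>}"

definition three_mult :: "('a, 'm) monoid_scheme \<Rightarrow> 'a set"
  where "three_mult A = (\<lambda>a. a [^]\<^bsub>A\<^esub> (3::nat)) ` carrier A"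

definition beta :: "('a, 'm) monoid_scheme \<Rightarrow> 'a \<Rightarrow> ('a \<Rightarrow> 'a)"
  where "beta A a = (\<lambda>x\<in>carrier A. a \<otimes>\<^bsub>A\<^esub> x)"

text \<open>\<open>affine_decomp A f f0 f1\<close> says \<open>f = f0 + f1\<close> with \<open>f0\<close> in \<open>A\<close> and \<open>f1\<close> an endomorphism
  of \<open>A\<close>. Such a decomposition of an endomorphism of \<open>\<^sub>cA\<close> exists uniquely, see
  \<open>ex1_affine_decomp\<close> below, so \<open>alpha\<close> is well defined.\<close>

definition affine_decomp ::
    "('a, 'm) monoid_scheme \<Rightarrow> ('a \<Rightarrow> 'a) \<Rightarrow> 'a \<Rightarrow> ('a \<Rightarrow> 'a) \<Rightarrow> bool"
  where "affine_decomp A f f0 f1 \<longleftrightarrow>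
    f0 \<in> carrier A \<and> f1 \<in> hom A A \<inter> extensional (carrier A) \<and>
    (\<forall>x\<in>carrier A. f x = f0 \<otimes>\<^bsub>A\<^esub> f1 x)"

definition alpha :: "('a, 'm) monoid_scheme \<Rightarrow> ('a \<Rightarrow> 'a) \<Rightarrow> ('a \<Rightarrow> 'a)"
  where "alpha A f = (THE f1. \<exists>f0. affine_decomp A f f0 f1)"

definition eta :: "('a, 'm) monoid_scheme \<Rightarrow> 'a \<Rightarrow> ('a \<Rightarrow> 'a) \<Rightarrow> 'a set"
  where "eta A c g = three_mult A #>\<^bsub>A\<^esub> (c \<otimes>\<^bsub>A\<^esub> inv\<^bsub>A\<^esub> g c)"

section \<open>Well-definedness\<close>

lemma carrier_elliptic_of [simp]: "carrier (elliptic_of A c) = carrier A"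
  by (simp add: elliptic_of_def)

lemma star_elliptic_of [simp]:
  "x \<star>\<^bsub>elliptic_of A c\<^esub> y = c \<otimes>\<^bsub>A\<^esub> inv\<^bsub>A\<^esub> x \<otimes>\<^bsub>A\<^esub> inv\<^bsub>A\<^esub> y"
  by (simp add: elliptic_of_def)

context comm_group
begin

lemma inv_cancel_left:
  "\<lbrakk>x \<in> carrier G; y \<in> carrier G\<rbrakk> \<Longrightarrow> x \<otimes> (inv x \<otimes> y) = y"
  "\<lbrakk>x \<in> carrier G; y \<in> carrier G\<rbrakk> \<Longrightarrow> inv x \<otimes> (x \<otimes> y) = y"
  by (simp_all add: m_assoc [symmetric])

lemma inv_cancel_right:
  "\<lbrakk>x \<in> carrier G; y \<in> carrier G\<rbrakk> \<Longrightarrow> x \<otimes> (y \<otimes> inv x) = y"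
  by (metis inv_cancel_left(1) inv_closed m_comm)

lemma elliptic_group_elliptic_of:
  assumes "c \<in> carrier G"
  shows "elliptic_group (elliptic_of G c)"
  by unfold_locales (use assms in \<open>simp_all add: inv_mult m_ac inv_cancel_left inv_cancel_right\<close>)

lemma subgroup_Ann3: "subgroup (Ann3 G) G"
  by (rule subgroupI) (auto simp: Ann3_def nat_pow_distrib nat_pow_inv)

lemma normal_three_mult: "three_mult G \<lhd> G"
proof (rule subgroup_imp_normal, rule subgroupI)
  show "three_mult G \<subseteq> carrier G" "three_mult G \<noteq> {}"
    by (auto simp: three_mult_def)
next
  fix a assume "a \<in> three_mult G"
  then show "inv a \<in> three_mult G"
    by (auto simp: three_mult_def nat_pow_inv [symmetric])
next
  fix a b assume "a \<in> three_mult G" "b \<in> three_mult G"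
  then show "a \<otimes> b \<in> three_mult G"
    by (auto simp: three_mult_def nat_pow_distrib [symmetric])
qed

lemma affine_decomp_unique:
  assumes "affine_decomp G f f0 f1" "affine_decomp G f h0 h1"
  shows "f0 = f \<one> \<and> h0 = f0 \<and> h1 = f1"
proof -
  have 1: "f0 \<in> carrier G" "h0 \<in> carrier G" "f1 \<in> hom G G" "h1 \<in> hom G G"
      "f1 \<in> extensional (carrier G)" "h1 \<in> extensional (carrier G)"
    and eq: "\<And>x. x \<in> carrier G \<Longrightarrow> f x = f0 \<otimes> f1 x" "\<And>x. x \<in> carrier G \<Longrightarrow> f x = h0 \<otimes> h1 x"
    using assms by (auto simp: affine_decomp_def)
  have one: "f1 \<one> = \<one>" "h1 \<one> = \<one>"
    using 1 hom_one is_group by blast+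
  have 0: "f0 = f \<one>" "h0 = f \<one>"
    using eq [of \<one>] one 1 by auto
  have "h1 x = f1 x" if "x \<in> carrier G" for x
  proof -
    have "h1 x \<in> carrier G" "f1 x \<in> carrier G"
      using 1 that by (auto simp: hom_def)
    then show ?thesis
      using eq that 0 1 by (metis l_cancel)
  qed
  then show ?thesis
    using 0 1 by (auto intro: extensionalityI)
qed

lemma ex1_affine_decomp:
  assumes c: "c \<in> carrier G" and f: "f \<in> elliptic_hom (elliptic_of G c) (elliptic_of G c)"
  shows "\<exists>!(f0, f1). affine_decomp G f f0 f1"
proof -
  have cl [simp]: "f x \<in> carrier G" if "x \<in> carrier G" for x
    using f that by (auto simp: elliptic_hom_def)
  have star: "f (c \<otimes> inv x \<otimes> inv y) = c \<otimes> inv f x \<otimes> inv f y"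
    if "x \<in> carrier G" "y \<in> carrier G" for x y
    using f that by (auto simp: elliptic_hom_def)
  have add: "f x \<otimes> f y = f (x \<otimes> y) \<otimes> f \<one>" if xy: "x \<in> carrier G" "y \<in> carrier G" for x y
  proof -
    have "c \<otimes> inv (f x \<otimes> f y) = f (c \<otimes> inv x \<otimes> inv y)"
      using star [OF xy] xy c by (simp add: inv_mult m_assoc)
    also have "\<dots> = f (c \<otimes> inv (x \<otimes> y) \<otimes> inv \<one>)"
      using xy c by (simp add: inv_mult m_assoc)
    also have "\<dots> = c \<otimes> inv (f (x \<otimes> y) \<otimes> f \<one>)"
      using star [of "x \<otimes> y" \<one>] xy c by (simp add: inv_mult m_assoc)
    finally have "inv (f x \<otimes> f y) = inv (f (x \<otimes> y) \<otimes> f \<one>)"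
      using xy c by simp
    then show ?thesis
      using xy by (metis cl inv_inv m_closed one_closed)
  qed
  define f1 where "f1 = (\<lambda>x\<in>carrier G. inv f \<one> \<otimes> f x)"
  have "f1 (x \<otimes> y) = f1 x \<otimes> f1 y" if xy: "x \<in> carrier G" "y \<in> carrier G" for x y
  proof -
    have "f1 x \<otimes> f1 y = inv f \<one> \<otimes> (inv f \<one> \<otimes> (f x \<otimes> f y))"
      using xy by (simp add: f1_def m_ac)
    also have "\<dots> = inv f \<one> \<otimes> f (x \<otimes> y)"
      unfolding add [OF xy] using xy by (simp add: m_ac inv_cancel_left)
    finally show ?thesis
      using xy by (simp add: f1_def)
  qed
  then have "affine_decomp G f (f \<one>) f1"
    by (auto simp: affine_decomp_def hom_def f1_def inv_cancel_left)
  then show ?thesis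
    using affine_decomp_unique by blast
qed

lemma alpha_eq:
  assumes "affine_decomp G f f0 f1"
  shows "alpha G f = f1"
  unfolding alpha_def using assms affine_decomp_unique by blast

end

end

theory Submission
  imports Defs
begin

text \<open>An endomap \<open>f\<^sub>0 + f\<^sub>1\<close> of \<open>A\<close> respects \<open>c - x - y\<close> iff \<open>3 f\<^sub>0 = c - f\<^sub>1(c)\<close>, and it is
  bijective iff \<open>f\<^sub>1\<close> is. So the automorphisms of \<open>\<^sub>cA\<close> lying over \<open>g\<close> correspond to the solutions
  \<open>a\<close> of \<open>3 a = c - g(c)\<close>: they exist iff the class of \<open>c - g(c)\<close> in \<open>A/3A\<close> vanishes, and for
  \<open>g = 1\<close> they are the elements of \<open>Ann\<^sub>3(A)\<close>.\<close>

section \<open>Automorphisms of an elliptic group inside its group of bijections\<close>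

lemma (in elliptic_group) inv_into_star:
  assumes "f \<in> elliptic_hom S S" "f \<in> Bij (carrier S)" "x \<in> carrier S" "y \<in> carrier S"
  shows "inv_into (carrier S) f (x \<star> y) = inv_into (carrier S) f x \<star> inv_into (carrier S) f y"
  by (rule Bij_inv_into_lemma) (use assms star_closed in \<open>auto simp: elliptic_hom_def\<close>)

text \<open>For an algebraic operation the inverse of a bijective morphism is again a morphism, so
  the categorical notion of automorphism reduces to bijectivity and elements can be handled inside
  \<open>BijGroup\<close>.\<close>

lemma (in elliptic_group) elliptic_auto_eq:
  "elliptic_auto S = elliptic_hom S S \<inter> Bij (carrier S)"
proof (intro equalityI subsetI)
  fix f assume "f \<in> elliptic_auto S"
  then obtain g where f: "f \<in> elliptic_hom S S" "f \<in> extensional (carrier S)"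
    and g: "g \<in> elliptic_hom S S" "\<And>x. x \<in> carrier S \<Longrightarrow> g (f x) = x \<and> f (g x) = x"
    by (auto simp: elliptic_auto_def)
  then have "bij_betw f (carrier S) (carrier S)"
    by (intro bij_betw_byWitness [where f' = g]) (auto simp: elliptic_hom_def)
  then show "f \<in> elliptic_hom S S \<inter> Bij (carrier S)"
    using f by (simp add: Bij_def)
next
  fix f assume f: "f \<in> elliptic_hom S S \<inter> Bij (carrier S)"
  \<comment> \<open>The inverse morphism in \<open>elliptic_auto\<close> need not be extensional, so
    \<open>inv_into\<close> serves without restriction to the carrier.\<close>
  define g where "g = inv_into (carrier S) f"
  have "g \<in> elliptic_hom S S"
    using f inv_into_star [of f] by (simp add: elliptic_hom_def g_def Bij_inv_into_mem)
  moreover have "\<forall>x\<in>carrier S. g (f x) = x \<and> f (g x) = x"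
    using f by (auto simp: g_def Bij_def bij_betw_inv_into_left bij_betw_inv_into_right)
  ultimately show "f \<in> elliptic_auto S"
    using f by (auto simp: elliptic_auto_def Bij_def)
qed

lemma carrier_EllipticAutoGroup: "carrier (EllipticAutoGroup S) = elliptic_auto S"
  by (simp add: EllipticAutoGroup_def)

text \<open>\<open>EllipticAutoGroup S\<close> is \<open>BijGroup\<close> with a smaller carrier, so
  its group axioms follow once this carrier is known to be a subgroup.\<close>

lemma (in elliptic_group) subgroup_elliptic_auto:
  "subgroup (elliptic_auto S) (BijGroup (carrier S))"
proof -
  interpret B: group "BijGroup (carrier S)"
    by (rule group_BijGroup)
  show ?thesis
  proof (rule B.subgroupI)
    show "elliptic_auto S \<subseteq> carrier (BijGroup (carrier S))"
      by (auto simp: elliptic_auto_eq BijGroup_def)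
    have "(\<lambda>x\<in>carrier S. x) \<in> elliptic_auto S"
      by (auto simp: elliptic_auto_eq elliptic_hom_def id_Bij star_closed)
    then show "elliptic_auto S \<noteq> {}"
      by blast
  next
    fix f assume "f \<in> elliptic_auto S"
    then show "inv\<^bsub>BijGroup (carrier S)\<^esub> f \<in> elliptic_auto S"
      \<comment> \<open>The inverse in \<open>BijGroup\<close> is \<open>inv_into\<close> restricted
        to the carrier. The restriction keeps it extensional and, by closure under the operation,
        does not disturb the morphism law.\<close>
      using restrict_inv_into_Bij [of f "carrier S"] inv_into_star [of f]
      by (auto simp: elliptic_auto_eq inv_BijGroup elliptic_hom_def Bij_inv_into_mem star_closed)
  next
    fix f g assume "f \<in> elliptic_auto S" "g \<in> elliptic_auto S"
    then show "f \<otimes>\<^bsub>BijGroup (carrier S)\<^esub> g \<in> elliptic_auto S"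
      by (auto simp: elliptic_auto_eq BijGroup_def compose_Bij elliptic_hom_def compose_eq star_closed Pi_iff)
  qed
qed

lemma (in elliptic_group) group_EllipticAutoGroup: "group (EllipticAutoGroup S)"
  by (simp add: EllipticAutoGroup_def group_BijGroup subgroup.subgroup_is_group
      subgroup_elliptic_auto)

section \<open>Affine maps as endomorphisms and automorphisms of
  \<open>elliptic_of G c\<close>\<close>

context comm_group
begin

lemma affine_decompD:
  assumes "affine_decomp G f f0 f1"
  shows "f0 \<in> carrier G" "f1 \<in> extensional (carrier G)"
    and "x \<in> carrier G \<Longrightarrow> f1 x \<in> carrier G"
    and "x \<in> carrier G \<Longrightarrow> f x = f0 \<otimes> f1 x"
    and "\<lbrakk>x \<in> carrier G; y \<in> carrier G\<rbrakk> \<Longrightarrow> f1 (x \<otimes> y) = f1 x \<otimes> f1 y"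
    and "x \<in> carrier G \<Longrightarrow> f1 (inv x) = inv (f1 x)"
proof -
  have f1: "f1 \<in> hom G G"
    using assms by (simp add: affine_decomp_def)
  then interpret group_hom G G f1
    by unfold_locales
  show "f0 \<in> carrier G" "f1 \<in> extensional (carrier G)"
    "x \<in> carrier G \<Longrightarrow> f1 x \<in> carrier G"
    "x \<in> carrier G \<Longrightarrow> f x = f0 \<otimes> f1 x"
    "\<lbrakk>x \<in> carrier G; y \<in> carrier G\<rbrakk> \<Longrightarrow> f1 (x \<otimes> y) = f1 x \<otimes> f1 y"
    "x \<in> carrier G \<Longrightarrow> f1 (inv x) = inv (f1 x)"
    using assms by (auto simp: affine_decomp_def)
qed

text \<open>With \<open>a = f0\<close> and \<open>b = f1 c\<close>, the left side is what the
  morphism law says at the neutral element, and the right side is the equation to be solved for the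
  constant term.\<close>

lemma mult_eq_inv_inv_iff_cube_eq:
  assumes "a \<in> carrier G" "b \<in> carrier G" "c \<in> carrier G"
  shows "a \<otimes> b = c \<otimes> inv a \<otimes> inv a \<longleftrightarrow> a [^] (3::nat) = c \<otimes> inv b"
proof -
  \<comment> \<open>Multiplying by \<open>a \<otimes> a\<close> removes both inverses on the right
    and collects a cube on the left.\<close>
  have "a \<otimes> b = c \<otimes> inv a \<otimes> inv a \<longleftrightarrow> a \<otimes> b \<otimes> (a \<otimes> a) = c \<otimes> inv a \<otimes> inv a \<otimes> (a \<otimes> a)"
    using assms by (intro right_cancel [symmetric]) auto
  also have "c \<otimes> inv a \<otimes> inv a \<otimes> (a \<otimes> a) = c"
    using assms by (simp add: m_assoc inv_cancel_left)
  also have "a \<otimes> b \<otimes> (a \<otimes> a) = a [^] (3::nat) \<otimes> b"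
    using assms by (simp add: numeral_3_eq_3 m_ac)
  also have "\<dots> = c \<longleftrightarrow> a [^] (3::nat) = c \<otimes> inv b"
    using assms by (metis inv_solve_right nat_pow_closed)
  finally show ?thesis .
qed

text \<open>Both sides of the morphism law contain the same factor
  \<open>inv f1 x \<otimes> inv f1 y\<close>. Cancelling it leaves one equation between constants,
  independent of \<open>x\<close> and \<open>y\<close>.\<close>

lemma affine_elliptic_hom_iff:
  assumes f: "affine_decomp G f f0 f1" and c: "c \<in> carrier G"
  shows "f \<in> elliptic_hom (elliptic_of G c) (elliptic_of G c)
    \<longleftrightarrow> f0 [^] (3::nat) = c \<otimes> inv f1 c"
proof -
  note [simp] = affine_decompD [OF f]
  have "f (c \<otimes> inv x \<otimes> inv y) = c \<otimes> inv f x \<otimes> inv f y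
      \<longleftrightarrow> f0 \<otimes> f1 c = c \<otimes> inv f0 \<otimes> inv f0" if xy: "x \<in> carrier G" "y \<in> carrier G" for x y
  proof -
    have "f (c \<otimes> inv x \<otimes> inv y) = f0 \<otimes> f1 c \<otimes> (inv f1 x \<otimes> inv f1 y)"
      using xy c by (simp add: m_assoc)
    moreover have "c \<otimes> inv f x \<otimes> inv f y = c \<otimes> inv f0 \<otimes> inv f0 \<otimes> (inv f1 x \<otimes> inv f1 y)"
      using xy c by (simp add: inv_mult m_ac)
    ultimately show ?thesis
      using xy c by simp
  qed
  moreover have "f \<in> carrier G \<rightarrow> carrier G"
    by auto
  ultimately have "f \<in> elliptic_hom (elliptic_of G c) (elliptic_of G c)
      \<longleftrightarrow> f0 \<otimes> f1 c = c \<otimes> inv f0 \<otimes> inv f0"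
    \<comment> \<open>\<open>\<one>\<close> is a point of the carrier, so the law quantified over
      all \<open>x\<close> and \<open>y\<close> is not vacuous and yields the constant
      equation.\<close>
    using one_closed by (auto simp: elliptic_hom_def)
  then show ?thesis
    using c by (simp add: mult_eq_inv_inv_iff_cube_eq)
qed

text \<open>\<open>f\<close> is \<open>f1\<close> followed by translation by \<open>f0\<close>,
  which is a bijection with translation by \<open>inv f0\<close> as inverse.\<close>

lemma affine_bij_betw_iff:
  assumes f: "affine_decomp G f f0 f1"
  shows "bij_betw f (carrier G) (carrier G) \<longleftrightarrow> bij_betw f1 (carrier G) (carrier G)"
proof -
  note [simp] = affine_decompD [OF f]
  have "bij_betw (\<lambda>x. f0 \<otimes> x) (carrier G) (carrier G)"
    by (rule bij_betw_byWitness [where f' = "\<lambda>x. inv f0 \<otimes> x"]) (auto simp: inv_cancel_left)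
  then have "bij_betw f1 (carrier G) (carrier G)
      \<longleftrightarrow> bij_betw ((\<lambda>x. f0 \<otimes> x) \<circ> f1) (carrier G) (carrier G)"
    by (intro bij_betw_comp_iff2) auto
  also have "\<dots> \<longleftrightarrow> bij_betw f (carrier G) (carrier G)"
    by (intro bij_betw_cong) simp
  finally show ?thesis
    by simp
qed

lemma affine_elliptic_auto_iff:
  assumes f: "affine_decomp G f f0 f1" and c: "c \<in> carrier G"
  shows "f \<in> elliptic_auto (elliptic_of G c) \<longleftrightarrow>
    f \<in> extensional (carrier G) \<and> f1 \<in> auto G \<and> f0 [^] (3::nat) = c \<otimes> inv f1 c"
proof -
  interpret E: elliptic_group "elliptic_of G c"
    using c by (rule elliptic_group_elliptic_of)
  \<comment> \<open>The decomposition already makes \<open>f1\<close> an extensional homomorphism,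
    so bijectivity is the only remaining condition.\<close>
  have "f1 \<in> auto G \<longleftrightarrow> bij_betw f (carrier G) (carrier G)"
    using f by (simp add: affine_bij_betw_iff [OF f] auto_def Bij_def) (simp add: affine_decomp_def)
  then show ?thesis
    by (auto simp: E.elliptic_auto_eq Bij_def affine_elliptic_hom_iff [OF f c])
qed

text \<open>Every endomorphism is affine by \<open>ex1_affine_decomp\<close>, so the criterion for
  affine maps reaches all automorphisms; its linear part is the value of
  \<open>alpha\<close>.\<close>

lemma elliptic_auto_affineE:
  assumes "f \<in> elliptic_auto (elliptic_of G c)" "c \<in> carrier G"
  obtains f0 f1 where "affine_decomp G f f0 f1" "f \<in> extensional (carrier G)" "f1 \<in> auto G"
    "f0 [^] (3::nat) = c \<otimes> inv f1 c" "alpha G f = f1"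
proof -
  have "f \<in> elliptic_hom (elliptic_of G c) (elliptic_of G c)"
    using assms by (simp add: elliptic_auto_def)
  then obtain f0 f1 where "affine_decomp G f f0 f1"
    using ex1_affine_decomp [OF assms(2)] by blast
  then show thesis
    using that assms affine_elliptic_auto_iff alpha_eq by blast
qed

text \<open>These are the candidate lifts of \<open>g\<close> along \<open>alpha\<close>; whether
  one is an automorphism depends on \<open>a\<close> alone.\<close>

lemma affine_decomp_restrict:
  assumes "a \<in> carrier G" "g \<in> auto G"
  shows "affine_decomp G (\<lambda>x\<in>carrier G. a \<otimes> g x) a g"
  using assms by (simp add: affine_decomp_def auto_def Bij_def)

lemma affine_decomp_beta:
  assumes "a \<in> carrier G"
  shows "affine_decomp G (beta G a) a (\<lambda>x\<in>carrier G. x)"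
  using assms by (simp add: affine_decomp_def beta_def hom_def Pi_iff)

text \<open>Expanding \<open>f0 + f1 (g0 + g1 x)\<close> shows that linear parts compose, which is
  why \<open>alpha\<close> is multiplicative. Only the constant term is twisted, by
  \<open>f1\<close>.\<close>

lemma affine_decomp_compose:
  assumes f: "affine_decomp G f f0 f1" and g: "affine_decomp G g g0 g1"
  shows "affine_decomp G (compose (carrier G) f g) (f0 \<otimes> f1 g0) (compose (carrier G) f1 g1)"
  unfolding affine_decomp_def
  using affine_decompD [OF f] affine_decompD [OF g]
  by (auto simp: hom_def compose_eq compose_extensional m_assoc)

text \<open>A translation has the identity as linear part, so the cube equation becomes
  \<open>3 a = c - c = 0\<close>.\<close>

lemma beta_in_elliptic_auto_iff:
  assumes "a \<in> carrier G" "c \<in> carrier G"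
  shows "beta G a \<in> elliptic_auto (elliptic_of G c) \<longleftrightarrow> a \<in> Ann3 G"
proof -
  have "beta G a \<in> extensional (carrier G)"
    by (simp add: beta_def)
  then show ?thesis
    using assms by (simp add: affine_elliptic_auto_iff [OF affine_decomp_beta] id_in_auto Ann3_def)
qed

lemma affine_decomp_id_imp_beta:
  assumes "affine_decomp G f a (\<lambda>x\<in>carrier G. x)" "f \<in> extensional (carrier G)"
  shows "f = beta G a"
  using assms by (auto simp: affine_decomp_def beta_def intro: extensionalityI)

text \<open>The multiplication of \<open>BijGroup\<close> is a function restricted to
  \<open>Bij\<close>, so it unfolds to composition only after both factors are known to be
  bijections.\<close>

lemma mult_EllipticAutoGroup:
  assumes "c \<in> carrier G"
    and "f \<in> elliptic_auto (elliptic_of G c)" "g \<in> elliptic_auto (elliptic_of G c)"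
  shows "f \<otimes>\<^bsub>EllipticAutoGroup (elliptic_of G c)\<^esub> g = compose (carrier G) f g"
proof -
  interpret E: elliptic_group "elliptic_of G c"
    using assms(1) by (rule elliptic_group_elliptic_of)
  show ?thesis
    using assms(2,3)
    by (simp add: E.elliptic_auto_eq EllipticAutoGroup_def BijGroup_def)
qed

section \<open>\<open>beta\<close> and \<open>alpha\<close> as group homomorphisms\<close>

lemma group_hom_beta:
  assumes c: "c \<in> carrier G"
  shows "group_hom (G\<lparr>carrier := Ann3 G\<rparr>) (EllipticAutoGroup (elliptic_of G c)) (beta G)"
proof -
  interpret E: elliptic_group "elliptic_of G c"
    using c by (rule elliptic_group_elliptic_of)
  have A: "a \<in> carrier G" if "a \<in> Ann3 G" for a
    using that by (simp add: Ann3_def)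
  have *: "beta G a \<in> elliptic_auto (elliptic_of G c)" if "a \<in> Ann3 G" for a
    using that c A beta_in_elliptic_auto_iff by blast
  have "beta G (a \<otimes> b) = compose (carrier G) (beta G a) (beta G b)"
    if "a \<in> Ann3 G" "b \<in> Ann3 G" for a b
    using A that by (auto simp: beta_def compose_def m_assoc)
  then have "beta G \<in> hom (G\<lparr>carrier := Ann3 G\<rparr>) (EllipticAutoGroup (elliptic_of G c))"
    using c * by (auto simp: hom_def carrier_EllipticAutoGroup mult_EllipticAutoGroup)
  then show ?thesis
    by (intro group_hom.intro group_hom_axioms.intro E.group_EllipticAutoGroup
        subgroup.subgroup_is_group [OF subgroup_Ann3 is_group])
qed

lemma group_hom_alpha:
  assumes c: "c \<in> carrier G"
  shows "group_hom (EllipticAutoGroup (elliptic_of G c)) (AutoGroup G) (alpha G)"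
proof -
  interpret E: elliptic_group "elliptic_of G c"
    using c by (rule elliptic_group_elliptic_of)
  have auto: "alpha G f \<in> auto G" if "f \<in> elliptic_auto (elliptic_of G c)" for f
    using that c by (auto elim: elliptic_auto_affineE)
  have "alpha G (compose (carrier G) f g) = compose (carrier G) (alpha G f) (alpha G g)"
    if f: "f \<in> elliptic_auto (elliptic_of G c)" and g: "g \<in> elliptic_auto (elliptic_of G c)" for f g
  proof -
    obtain f0 where f': "affine_decomp G f f0 (alpha G f)"
      by (rule elliptic_auto_affineE [OF f c]) blast
    obtain g0 where g': "affine_decomp G g g0 (alpha G g)"
      by (rule elliptic_auto_affineE [OF g c]) blast
    show ?thesis
      using affine_decomp_compose [OF f' g'] by (rule alpha_eq)
  qed
  then have "alpha G \<in> hom (EllipticAutoGroup (elliptic_of G c)) (AutoGroup G)"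
    using c auto
    by (auto simp: hom_def carrier_EllipticAutoGroup mult_EllipticAutoGroup)
      (auto simp: AutoGroup_def BijGroup_def auto_def)
  then show ?thesis
    by (intro group_hom.intro group_hom_axioms.intro E.group_EllipticAutoGroup AutoGroup)
qed

section \<open>The map \<open>eta\<close> and exactness at each term\<close>

lemma eta_eq_one_iff:
  assumes "c \<in> carrier G" "g \<in> auto G"
  shows "eta G c g = \<one>\<^bsub>G Mod three_mult G\<^esub> \<longleftrightarrow> c \<otimes> inv g c \<in> three_mult G"
proof -
  have sub: "subgroup (three_mult G) G"
    using normal_three_mult by (rule normal_imp_subgroup)
  have "g c \<in> carrier G"
    using assms by (auto simp: auto_def hom_def)
  then have "c \<otimes> inv g c \<in> carrier G"
    using assms by simp
  then show ?thesis
    \<comment> \<open>The neutral element of the quotient is \<open>three_mult G\<close> itself, and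
      a coset of a subgroup equals the subgroup exactly when its representative lies in it.\<close>
    using coset_join1 [OF _ _ sub] coset_join2 [OF _ sub] by (auto simp: eta_def FactGroup_def)
qed

lemma kernel_beta:
  "kernel (G\<lparr>carrier := Ann3 G\<rparr>) (EllipticAutoGroup (elliptic_of G c)) (beta G) = {\<one>}"
proof -
  \<comment> \<open>Evaluating a translation at \<open>\<one>\<close> recovers its translation
    vector.\<close>
  have "a = \<one>" if "a \<in> carrier G" "beta G a = (\<lambda>x\<in>carrier G. x)" for a
    using that(1) fun_cong [OF that(2), of \<one>] by (simp add: beta_def)
  moreover have "beta G \<one> = (\<lambda>x\<in>carrier G. x)"
    by (auto simp: beta_def)
  ultimately show ?thesis
    by (auto simp: kernel_def EllipticAutoGroup_def BijGroup_def Ann3_def)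
qed

lemma image_beta:
  assumes c: "c \<in> carrier G"
  shows "beta G ` Ann3 G = kernel (EllipticAutoGroup (elliptic_of G c)) (AutoGroup G) (alpha G)"
proof -
  have ker: "kernel (EllipticAutoGroup (elliptic_of G c)) (AutoGroup G) (alpha G)
      = {f \<in> elliptic_auto (elliptic_of G c). alpha G f = (\<lambda>x\<in>carrier G. x)}"
    by (simp add: kernel_def EllipticAutoGroup_def AutoGroup_def BijGroup_def)
  show ?thesis
    unfolding ker
  proof (intro equalityI subsetI)
    fix f assume "f \<in> beta G ` Ann3 G"
    then obtain a where "f = beta G a" "a \<in> Ann3 G" "a \<in> carrier G"
      by (auto simp: Ann3_def)
    then show "f \<in> {f \<in> elliptic_auto (elliptic_of G c). alpha G f = (\<lambda>x\<in>carrier G. x)}"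
      using c by (simp add: beta_in_elliptic_auto_iff alpha_eq [OF affine_decomp_beta])
  next
    fix f assume "f \<in> {f \<in> elliptic_auto (elliptic_of G c). alpha G f = (\<lambda>x\<in>carrier G. x)}"
    then have f: "f \<in> elliptic_auto (elliptic_of G c)" and "alpha G f = (\<lambda>x\<in>carrier G. x)"
      by auto
    \<comment> \<open>The linear part of \<open>f\<close> is \<open>alpha G f\<close>, here the
      identity, so \<open>f\<close> is translation by its constant term \<open>a\<close>.\<close>
    then obtain a where "affine_decomp G f a (\<lambda>x\<in>carrier G. x)" "f \<in> extensional (carrier G)"
      using c by (metis elliptic_auto_affineE)
    then have "f = beta G a" "a \<in> carrier G"
      by (auto simp: affine_decomp_id_imp_beta affine_decompD)
    then show "f \<in> beta G ` Ann3 G"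
      using f c by (auto simp: beta_in_elliptic_auto_iff)
  qed
qed

text \<open>The cube equation says that \<open>c \<otimes> inv g c\<close> has a cube root, namely
  the constant term of a lift. Conversely, any cube root gives a lift of \<open>g\<close>.\<close>

lemma image_alpha:
  assumes c: "c \<in> carrier G"
  shows "alpha G ` carrier (EllipticAutoGroup (elliptic_of G c))
    = {g \<in> carrier (AutoGroup G). eta G c g = \<one>\<^bsub>G Mod three_mult G\<^esub>}"
proof -
  have "alpha G ` elliptic_auto (elliptic_of G c) = {g \<in> auto G. c \<otimes> inv g c \<in> three_mult G}"
  proof (intro equalityI subsetI)
    fix g assume "g \<in> alpha G ` elliptic_auto (elliptic_of G c)"
    then obtain f where f: "f \<in> elliptic_auto (elliptic_of G c)" and "g = alpha G f"
      by blast
    then obtain a where "affine_decomp G f a g" "g \<in> auto G" "a [^] (3::nat) = c \<otimes> inv g c"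
      using elliptic_auto_affineE [OF f c] by metis
    then show "g \<in> {g \<in> auto G. c \<otimes> inv g c \<in> three_mult G}"
      by (auto simp: three_mult_def affine_decompD intro!: image_eqI [of _ _ a])
  next
    fix g assume "g \<in> {g \<in> auto G. c \<otimes> inv g c \<in> three_mult G}"
    \<comment> \<open>Membership in \<open>three_mult G\<close> provides the cube root
      \<open>a\<close>, used as the constant term of the lift.\<close>
    then obtain a where a: "a \<in> carrier G" "a [^] (3::nat) = c \<otimes> inv g c" and g: "g \<in> auto G"
      by (auto simp: three_mult_def)
    note dec = affine_decomp_restrict [OF a(1) g]
    have "(\<lambda>x\<in>carrier G. a \<otimes> g x) \<in> elliptic_auto (elliptic_of G c)"
      using a g by (simp add: affine_elliptic_auto_iff [OF dec c])
    then show "g \<in> alpha G ` elliptic_auto (elliptic_of G c)"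
      using alpha_eq [OF dec] by force
  qed
  then show ?thesis
    using c eta_eq_one_iff by (auto simp: EllipticAutoGroup_def AutoGroup_def)
qed

lemma eta_closed:
  assumes c: "c \<in> carrier G"
  shows "eta G c \<in> carrier (AutoGroup G) \<rightarrow> carrier (G Mod three_mult G)"
proof
  fix g assume "g \<in> carrier (AutoGroup G)"
  then have "c \<otimes> inv g c \<in> carrier G"
    using c by (auto simp: AutoGroup_def auto_def hom_def)
  then show "eta G c g \<in> carrier (G Mod three_mult G)"
    using subgroup.subset [OF normal_imp_subgroup [OF normal_three_mult]]
    by (simp add: eta_def FactGroup_def rcosetsI)
qed

text \<open>This is the base point condition for \<open>eta\<close> as a map of pointed sets: at the
  identity the representative is \<open>c - c\<close>.\<close>

lemma eta_one:
  assumes c: "c \<in> carrier G"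
  shows "eta G c \<one>\<^bsub>AutoGroup G\<^esub> = \<one>\<^bsub>G Mod three_mult G\<^esub>"
  using c subgroup.subset [OF normal_imp_subgroup [OF normal_three_mult]]
  by (simp add: eta_def AutoGroup_def BijGroup_def FactGroup_def)

end

theorem proposition11p1:
  fixes A :: "('a, 'm) monoid_scheme" and c :: 'a
  assumes "comm_group A" and "c \<in> carrier A"
  shows "group_hom (A\<lparr>carrier := Ann3 A\<rparr>) (EllipticAutoGroup (elliptic_of A c)) (beta A)
    \<and> group_hom (EllipticAutoGroup (elliptic_of A c)) (AutoGroup A) (alpha A)
    \<and> eta A c \<in> carrier (AutoGroup A) \<rightarrow> carrier (A Mod three_mult A)
    \<and> eta A c \<one>\<^bsub>AutoGroup A\<^esub> = \<one>\<^bsub>A Mod three_mult A\<^esub>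
    \<and> kernel (A\<lparr>carrier := Ann3 A\<rparr>) (EllipticAutoGroup (elliptic_of A c)) (beta A) = {\<one>\<^bsub>A\<^esub>}
    \<and> beta A ` Ann3 A = kernel (EllipticAutoGroup (elliptic_of A c)) (AutoGroup A) (alpha A)
    \<and> alpha A ` carrier (EllipticAutoGroup (elliptic_of A c))
        = {g \<in> carrier (AutoGroup A). eta A c g = \<one>\<^bsub>A Mod three_mult A\<^esub>}"
proof -
  interpret A: comm_group A
    by (fact assms(1))
  note c = assms(2)
  show ?thesis
    by (intro conjI A.group_hom_beta [OF c] A.group_hom_alpha [OF c] A.eta_closed [OF c]
        A.eta_one [OF c] A.kernel_beta A.image_beta [OF c] A.image_alpha [OF c])
qed

end
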